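(* Let $\varepsilon>0$. The matrices $$E_\varepsilon=\left[\frac{j-i}{(i+j+1)(\log(i+j+1))^{1+\varepsilon}}\right]_{i,j\ge 1}$$ and $$F_\varepsilon=\left[\frac{j-i}{(i+j+1)(\log(i+j+1))(\log\log(i+j+1))^{1+\varepsilon}}\right]_{i,j\ge 1}$$ are Schur multipliers.
   Context: The Schur product of two matrices $A=[a_{ij}]_{i,j\ge 1}$ and $B=[b_{ij}]_{i,j\ge 1}$ is the entrywise product $A\ast B=[a_{ij}b_{ij}]_{i,j\ge 1}$. Operators in $B(\ell_2)$ are identified with their matrices in the standard basis (indexed by $i,j\ge 1$). An infinite matrix $M$ of scalars is a Schur multiplier if $M\ast A\in B(\ell_2)$ for every $A\in B(\ell_2)$ and the map $\mathcal{S}_M:B(\ell_2)\to B(\ell_2)$, $\mathcal{S}_M(A)=M\ast A$, is bounded. *)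

theory Defs
  imports "HOL-Analysis.Analysis"
begin

text \<open>
  The Hilbert space \<open>\<ell>\<^sub>2\<close> over the complex numbers.  Coordinates are indexed by \<^typ>\<open>nat\<close>: the
  coordinate (row, column) numbered \<open>i \<ge> 1\<close> in the mathematical text is stored at position
  \<open>i - 1\<close>.
\<close>

lemma square_norm_add_le:
  fixes a b :: "'a::real_normed_vector"
  shows "(norm (a + b))\<^sup>2 \<le> 2 * (norm a)\<^sup>2 + 2 * (norm b)\<^sup>2"
proof -
  have "(norm (a + b))\<^sup>2 \<le> (norm a + norm b)\<^sup>2"
    by (intro power_mono norm_triangle_ineq) auto
  also have "\<dots> \<le> 2 * (norm a)\<^sup>2 + 2 * (norm b)\<^sup>2"
    using sum_squares_bound[of "norm a" "norm b"] by (simp add: power2_sum)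
  finally show ?thesis .
qed

lemma summable_square_add:
  fixes x y :: "nat \<Rightarrow> complex"
  assumes "summable (\<lambda>i. (norm (x i))\<^sup>2)" "summable (\<lambda>i. (norm (y i))\<^sup>2)"
  shows "summable (\<lambda>i. (norm (x i + y i))\<^sup>2)"
proof (rule summable_comparison_test')
  show "summable (\<lambda>i. 2 * (norm (x i))\<^sup>2 + 2 * (norm (y i))\<^sup>2)"
    by (intro summable_add summable_mult assms)
  show "norm ((norm (x i + y i))\<^sup>2) \<le> 2 * (norm (x i))\<^sup>2 + 2 * (norm (y i))\<^sup>2" if "i \<ge> 0" for i
    using square_norm_add_le[of "x i" "y i"] by simp
qed

lemma summable_square_mult:
  fixes x :: "nat \<Rightarrow> complex"
  assumes "summable (\<lambda>i. (norm (x i))\<^sup>2)"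
  shows "summable (\<lambda>i. (norm (c * x i))\<^sup>2)"
  using summable_mult[OF assms, of "(norm c)\<^sup>2"] by (simp add: norm_mult power_mult_distrib)

typedef ell2 = "{x :: nat \<Rightarrow> complex. summable (\<lambda>i. (norm (x i))\<^sup>2)}"
  morphisms ell2_nth Abs_ell2
  by (rule exI[of _ "\<lambda>_. 0"]) simp

setup_lifting type_definition_ell2

lemma summable_ell2: "summable (\<lambda>i. (norm (ell2_nth x i))\<^sup>2)"
  using ell2_nth by auto

lift_definition ell2_scale :: "complex \<Rightarrow> ell2 \<Rightarrow> ell2" is "\<lambda>c x i. c * x i"
  by (rule summable_square_mult)

lift_definition ell2_basis :: "nat \<Rightarrow> ell2" is "\<lambda>j i. if i = j then 1 else 0"
proof -
  fix j :: nat
  show "summable (\<lambda>i. (norm (if i = j then 1 else 0 :: complex))\<^sup>2)"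
    by (rule summable_finite[of "{j}"]) auto
qed

instantiation ell2 :: real_vector
begin

lift_definition zero_ell2 :: ell2 is "\<lambda>_. 0" by simp

lift_definition plus_ell2 :: "ell2 \<Rightarrow> ell2 \<Rightarrow> ell2" is "\<lambda>x y i. x i + y i"
  by (rule summable_square_add)

lift_definition uminus_ell2 :: "ell2 \<Rightarrow> ell2" is "\<lambda>x i. - x i" by simp

lift_definition minus_ell2 :: "ell2 \<Rightarrow> ell2 \<Rightarrow> ell2" is "\<lambda>x y i. x i - y i"
  subgoal for x y using summable_square_add[of x "\<lambda>i. - y i"] by simp
  done

lift_definition scaleR_ell2 :: "real \<Rightarrow> ell2 \<Rightarrow> ell2" is "\<lambda>r x i. complex_of_real r * x i"
  by (rule summable_square_mult)

instance
proof
  fix x y z :: ell2 and a b :: real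
  show "x + y + z = x + (y + z)" by transfer (simp add: add.assoc)
  show "x + y = y + x" by transfer (simp add: add.commute)
  show "0 + x = x" by transfer simp
  show "- x + x = 0" by transfer simp
  show "x - y = x + - y" by transfer simp
  show "a *\<^sub>R (x + y) = a *\<^sub>R x + a *\<^sub>R y" by transfer (simp add: algebra_simps)
  show "(a + b) *\<^sub>R x = a *\<^sub>R x + b *\<^sub>R x" by transfer (simp add: algebra_simps)
  show "a *\<^sub>R b *\<^sub>R x = (a * b) *\<^sub>R x" by transfer (simp add: mult.assoc)
  show "1 *\<^sub>R x = x" by transfer simp
qed

end

instantiation ell2 :: real_normed_vector
begin

lift_definition norm_ell2 :: "ell2 \<Rightarrow> real" is "\<lambda>x. sqrt (\<Sum>i. (norm (x i))\<^sup>2)" .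

definition dist_ell2 :: "ell2 \<Rightarrow> ell2 \<Rightarrow> real" where "dist_ell2 x y = norm (x - y)"

definition sgn_ell2 :: "ell2 \<Rightarrow> ell2" where "sgn_ell2 x = x /\<^sub>R norm x"

definition uniformity_ell2 :: "(ell2 \<times> ell2) filter" where
  "uniformity_ell2 = (INF e\<in>{0<..}. principal {(x, y). dist x y < e})"

definition open_ell2 :: "ell2 set \<Rightarrow> bool" where
  "open_ell2 U \<longleftrightarrow> (\<forall>x\<in>U. eventually (\<lambda>(x', y). x' = x \<longrightarrow> y \<in> U) uniformity)"

instance
proof
  fix x y :: ell2 and a :: real and U :: "ell2 set"
  show "dist x y = norm (x - y)" by (rule dist_ell2_def)
  show "sgn x = x /\<^sub>R norm x" by (rule sgn_ell2_def)
  show "uniformity = (INF e\<in>{0<..}. principal {(x::ell2, y). dist x y < e})"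
    by (rule uniformity_ell2_def)
  show "open U \<longleftrightarrow> (\<forall>x\<in>U. eventually (\<lambda>(x', y). x' = x \<longrightarrow> y \<in> U) uniformity)"
    by (rule open_ell2_def)
  show "norm x = 0 \<longleftrightarrow> x = 0"
    by transfer (auto simp: suminf_eq_zero_iff)
  show "norm (a *\<^sub>R x) = \<bar>a\<bar> * norm x"
    by transfer (simp add: norm_mult power_mult_distrib suminf_mult real_sqrt_mult)
  show "norm (x + y) \<le> norm x + norm y"
  proof transfer
    fix x y :: "nat \<Rightarrow> complex"
    assume x: "summable (\<lambda>i. (norm (x i))\<^sup>2)" and y: "summable (\<lambda>i. (norm (y i))\<^sup>2)"
    let ?N = "\<lambda>x :: nat \<Rightarrow> complex. sqrt (\<Sum>i. (norm (x i))\<^sup>2)"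
    have xy: "summable (\<lambda>i. (norm (x i + y i))\<^sup>2)" by (rule summable_square_add[OF x y])
    have nn: "0 \<le> ?N x" "0 \<le> ?N y" using x y by (auto intro: suminf_nonneg)
    have "(\<Sum>i. (norm (x i + y i))\<^sup>2) \<le> (?N x + ?N y)\<^sup>2"
    proof (rule suminf_le_const[OF xy])
      fix n
      have "(\<Sum>i<n. (norm (x i + y i))\<^sup>2) \<le> (\<Sum>i<n. (norm (x i) + norm (y i))\<^sup>2)"
        by (intro sum_mono power_mono norm_triangle_ineq) auto
      also have "\<dots> = (L2_set (\<lambda>i. norm (x i) + norm (y i)) {..<n})\<^sup>2"
        by (simp add: L2_set_def sum_nonneg)
      also have "\<dots> \<le> (L2_set (\<lambda>i. norm (x i)) {..<n} + L2_set (\<lambda>i. norm (y i)) {..<n})\<^sup>2"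
        by (intro power_mono L2_set_triangle_ineq L2_set_nonneg)
      also have "\<dots> \<le> (?N x + ?N y)\<^sup>2"
        unfolding L2_set_def
        by (intro power_mono add_mono real_sqrt_le_mono sum_le_suminf x y add_nonneg_nonneg)
           (auto intro: sum_nonneg)
      finally show "(\<Sum>i<n. (norm (x i + y i))\<^sup>2) \<le> (?N x + ?N y)\<^sup>2" .
    qed
    then show "?N (\<lambda>i. x i + y i) \<le> ?N x + ?N y"
      using nn by (intro real_le_lsqrt) auto
  qed
qed

end

text \<open>
  \<open>B(\<ell>\<^sub>2)\<close>: the type of bounded linear functions only records real linearity, so complex
  homogeneity is required in addition.  The norm is the operator norm of that type.
\<close>

definition B_ell2 :: "(ell2 \<Rightarrow>\<^sub>L ell2) set" where
  "B_ell2 = {A. \<forall>c x. blinfun_apply A (ell2_scale c x) = ell2_scale c (blinfun_apply A x)}"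

definition matrix_of :: "(ell2 \<Rightarrow>\<^sub>L ell2) \<Rightarrow> nat \<Rightarrow> nat \<Rightarrow> complex" where
  "matrix_of A i j = ell2_nth (blinfun_apply A (ell2_basis j)) i"

definition schur_product ::
    "(nat \<Rightarrow> nat \<Rightarrow> complex) \<Rightarrow> (nat \<Rightarrow> nat \<Rightarrow> complex) \<Rightarrow> nat \<Rightarrow> nat \<Rightarrow> complex" where
  "schur_product A B i j = A i j * B i j"

text \<open>An operator in \<open>B(\<ell>\<^sub>2)\<close> is determined by its matrix.\<close>

lemma ell2_nth_add: "ell2_nth (x + y) i = ell2_nth x i + ell2_nth y i"
  by transfer simp

lemma ell2_nth_diff: "ell2_nth (x - y) i = ell2_nth x i - ell2_nth y i"
  by transfer simp

lemma ell2_nth_scale: "ell2_nth (ell2_scale c x) i = c * ell2_nth x i"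
  by transfer simp

lemma ell2_nth_basis: "ell2_nth (ell2_basis j) i = (if i = j then 1 else 0)"
  by transfer simp

lemma ell2_nth_sum: "ell2_nth (sum f S) i = (\<Sum>k\<in>S. ell2_nth (f k) i)"
  by (induction S rule: infinite_finite_induct) (auto simp: ell2_nth_add zero_ell2.rep_eq)

lemma ell2_expansion:
  "(\<lambda>n. \<Sum>j<n. ell2_scale (ell2_nth x j) (ell2_basis j)) \<longlonglongrightarrow> x"
proof -
  let ?s = "\<lambda>n. \<Sum>j<n. ell2_scale (ell2_nth x j) (ell2_basis j)"
  let ?f = "\<lambda>i. (norm (ell2_nth x i))\<^sup>2"
  have nth: "ell2_nth (x - ?s n) i = (if i < n then 0 else ell2_nth x i)" for n i
    by (simp add: ell2_nth_diff ell2_nth_sum ell2_nth_scale ell2_nth_basis if_distrib sum.delta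
        cong: if_cong)
  have "norm (x - ?s n) = sqrt (\<Sum>i. ?f (i + n))" for n
  proof -
    have sm: "summable (\<lambda>i. (norm (ell2_nth (x - ?s n) i))\<^sup>2)" by (rule summable_ell2)
    have "norm (x - ?s n) = sqrt (\<Sum>i. (norm (ell2_nth (x - ?s n) i))\<^sup>2)"
      by (simp add: norm_ell2.rep_eq)
    also have "(\<Sum>i. (norm (ell2_nth (x - ?s n) i))\<^sup>2)
        = (\<Sum>i. (norm (ell2_nth (x - ?s n) (i + n)))\<^sup>2) + (\<Sum>i<n. (norm (ell2_nth (x - ?s n) i))\<^sup>2)"
      by (rule suminf_split_initial_segment[OF sm])
    also have "\<dots> = (\<Sum>i. ?f (i + n))" by (simp add: nth)
    finally show ?thesis .
  qed
  moreover have "(\<lambda>n. sqrt (\<Sum>i. ?f (i + n))) \<longlonglongrightarrow> sqrt 0"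
    by (intro tendsto_real_sqrt suminf_exist_split2 summable_ell2)
  ultimately have "(\<lambda>n. norm (x - ?s n)) \<longlonglongrightarrow> 0" by simp
  then have "(\<lambda>n. x - ?s n) \<longlonglongrightarrow> 0" by (rule tendsto_norm_zero_cancel)
  from tendsto_diff[OF tendsto_const[of x] this] show ?thesis by simp
qed

lemma matrix_of_inject:
  assumes "A \<in> B_ell2" "B \<in> B_ell2" "matrix_of A = matrix_of B"
  shows "A = B"
proof (rule blinfun_eqI)
  fix x
  have basis: "blinfun_apply A (ell2_basis j) = blinfun_apply B (ell2_basis j)" for j
  proof (rule iffD1[OF ell2_nth_inject], rule ext)
    show "ell2_nth (blinfun_apply A (ell2_basis j)) i = ell2_nth (blinfun_apply B (ell2_basis j)) i" for i
      using fun_cong[OF fun_cong[OF assms(3)], of i j] by (simp add: matrix_of_def)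
  qed
  let ?s = "\<lambda>n. \<Sum>j<n. ell2_scale (ell2_nth x j) (ell2_basis j)"
  have "blinfun_apply A (?s n) = blinfun_apply B (?s n)" for n
    using assms(1,2) basis by (simp add: blinfun.sum_right B_ell2_def)
  moreover have "(\<lambda>n. blinfun_apply A (?s n)) \<longlonglongrightarrow> blinfun_apply A x"
    "(\<lambda>n. blinfun_apply B (?s n)) \<longlonglongrightarrow> blinfun_apply B x"
    by (intro blinfun.tendsto tendsto_const ell2_expansion)+
  ultimately show "blinfun_apply A x = blinfun_apply B x"
    by (simp add: LIMSEQ_unique)
qed

text \<open>
  By \<open>matrix_of_inject\<close>, the map \<open>S\<close> below is uniquely determined on \<^const>\<open>B_ell2\<close>: it is
  \<open>A \<mapsto> M * A\<close>.
\<close>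

definition schur_multiplier :: "(nat \<Rightarrow> nat \<Rightarrow> complex) \<Rightarrow> bool" where
  "schur_multiplier M \<longleftrightarrow>
    (\<exists>S. (\<forall>A\<in>B_ell2. S A \<in> B_ell2 \<and> matrix_of (S A) = schur_product M (matrix_of A)) \<and>
         (\<exists>K. \<forall>A\<in>B_ell2. norm (S A) \<le> K * norm A))"

text \<open>The two matrices with their original indices \<open>i, j \<ge> 1\<close>.\<close>

definition E_entry :: "real \<Rightarrow> nat \<Rightarrow> nat \<Rightarrow> real" where
  "E_entry \<epsilon> i j =
    (real j - real i) / (real (i + j + 1) * ln (real (i + j + 1)) powr (1 + \<epsilon>))"

definition F_entry :: "real \<Rightarrow> nat \<Rightarrow> nat \<Rightarrow> real" where
  "F_entry \<epsilon> i j =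
    (real j - real i) /
      (real (i + j + 1) * ln (real (i + j + 1)) * ln (ln (real (i + j + 1))) powr (1 + \<epsilon>))"

end

theory Submission
  imports Defs
begin

text \<open>
  Shifting the indices to start at \<open>0\<close>, both matrices have the shape \<open>(j - i) h(i + j)\<close> with a
  positive sequence \<open>h\<close> that is convex and summable.  These two properties suffice
  (\<open>schur_bound_convex_hankel\<close>), with norm at most \<open>4 \<Sum> h\<close>.

  A convex summable sequence is a superposition of triangles:
  \<open>h(n) = \<Sum>\<^sub>N (N - n)\<^sub>+ c\<^sub>N\<close>, where \<open>c\<^sub>N \<ge> 0\<close> is the second difference of \<open>h\<close> around \<open>N\<close>.
  The triangle \<open>(N - i - j)\<^sub>+\<close> counts the \<open>m\<close> with \<open>i \<le> m < N - j\<close>, so it is the inner product of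
  the indicators of \<open>{i..<N}\<close> and \<open>{0..<N - j}\<close>, both of norm at most \<open>\<surd>N\<close>.  A matrix of inner
  products of vectors of norm at most \<open>\<surd>C\<close> is a Schur multiplier of norm at most \<open>C\<close>
  (\<open>schur_bound_gram\<close>); hence the triangle has norm at most \<open>N\<close>.  It vanishes unless
  \<open>i, j < N\<close>, so the extra factors \<open>j\<close> and \<open>i\<close> act on it as diagonal matrices bounded by \<open>N\<close>, and
  \<open>(j - i) (N - i - j)\<^sub>+\<close> has norm at most \<open>2 N\<^sup>2\<close>.  Summing by parts twice gives
  \<open>\<Sum>\<^sub>N N\<^sup>2 c\<^sub>N \<le> 2 \<Sum> h\<close> (\<open>second_difference_moment_le\<close>), so the superposition converges boundedly.

  It remains to treat the two weights.  The logarithm of a log-concave sequence is concave, and a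
  positive concave sequence is log-concave; so \<open>x\<close>, \<open>log x\<close> and \<open>log log x\<close>, sampled at
  \<open>x = 3, 4, \<dots>\<close>, where all three are positive, are log-concave, and so are products of their
  nonnegative powers.  The reciprocal of a log-concave sequence is convex.  Summability is a telescoping
  estimate: \<open>1 / x\<close> and \<open>1 / (x log x)\<close> are at most the increments over \<open>[x - 1, x]\<close> of \<open>u = log x\<close> and of \<open>u = log log x\<close>,
  and the quotients of these increments by \<open>u\<^bsup>1 + \<epsilon>\<^esup>\<close> are dominated by those of \<open>- u\<^bsup>- \<epsilon>\<^esup> / \<epsilon>\<close>.
\<close>

section \<open>Bounded forms and bounded Schur multiplication\<close>

text \<open>
  The matrices of operators of norm at most \<open>B\<close>, described by their finite square sections only.
  In this form, pointwise limits are immediate and no series has to converge.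
\<close>

definition form_bound :: "(nat \<Rightarrow> nat \<Rightarrow> complex) \<Rightarrow> real \<Rightarrow> bool" where
  "form_bound a B \<longleftrightarrow> (\<forall>n \<xi> \<eta>. cmod (\<Sum>i<n. \<Sum>j<n. a i j * \<xi> j * \<eta> i)
     \<le> B * L2_set (\<lambda>j. cmod (\<xi> j)) {..<n} * L2_set (\<lambda>i. cmod (\<eta> i)) {..<n})"

definition schur_bound :: "(nat \<Rightarrow> nat \<Rightarrow> complex) \<Rightarrow> real \<Rightarrow> bool" where
  "schur_bound M C \<longleftrightarrow> (\<forall>a B. form_bound a B \<longrightarrow> form_bound (schur_product M a) (C * B))"

lemma form_boundD:
  fixes \<xi> \<eta> :: "nat \<Rightarrow> complex"
  shows "form_bound a B \<Longrightarrow> cmod (\<Sum>i<n. \<Sum>j<n. a i j * \<xi> j * \<eta> i)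
     \<le> B * L2_set (\<lambda>j. cmod (\<xi> j)) {..<n} * L2_set (\<lambda>i. cmod (\<eta> i)) {..<n}"
  unfolding form_bound_def by blast

lemma form_bound_nonneg:
  assumes "form_bound a B"
  shows "0 \<le> B"
proof -
  have "cmod (a 0 0) \<le> B"
    using form_boundD[OF assms, where n = 1 and \<xi> = "\<lambda>_. 1" and \<eta> = "\<lambda>_. 1"]
    by (simp add: L2_set_def)
  then show ?thesis using norm_ge_zero order_trans by blast
qed

lemma form_bound_mono:
  assumes "form_bound a B" "B \<le> B'"
  shows "form_bound a B'"
  unfolding form_bound_def
proof (intro allI)
  fix n :: nat and \<xi> \<eta> :: "nat \<Rightarrow> complex"
  show "cmod (\<Sum>i<n. \<Sum>j<n. a i j * \<xi> j * \<eta> i)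
     \<le> B' * L2_set (\<lambda>j. cmod (\<xi> j)) {..<n} * L2_set (\<lambda>i. cmod (\<eta> i)) {..<n}"
    by (rule order_trans[OF form_boundD[OF assms(1)]])
      (intro mult_right_mono assms(2) L2_set_nonneg)
qed

lemma form_bound_zero: "form_bound (\<lambda>_ _. 0) 0"
  by (simp add: form_bound_def)

lemma form_bound_add:
  assumes "form_bound a A" "form_bound b B"
  shows "form_bound (\<lambda>i j. a i j + b i j) (A + B)"
  unfolding form_bound_def
proof (intro allI)
  fix n :: nat and \<xi> \<eta> :: "nat \<Rightarrow> complex"
  have "(\<Sum>i<n. \<Sum>j<n. (a i j + b i j) * \<xi> j * \<eta> i)
      = (\<Sum>i<n. \<Sum>j<n. a i j * \<xi> j * \<eta> i) + (\<Sum>i<n. \<Sum>j<n. b i j * \<xi> j * \<eta> i)"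
    by (simp add: algebra_simps sum.distrib)
  also have "cmod \<dots> \<le> cmod (\<Sum>i<n. \<Sum>j<n. a i j * \<xi> j * \<eta> i)
      + cmod (\<Sum>i<n. \<Sum>j<n. b i j * \<xi> j * \<eta> i)"
    by (rule norm_triangle_ineq)
  also have "\<dots> \<le> (A + B) * L2_set (\<lambda>j. cmod (\<xi> j)) {..<n} * L2_set (\<lambda>i. cmod (\<eta> i)) {..<n}"
    using add_mono[OF form_boundD[OF assms(1), where n = n and \<xi> = \<xi> and \<eta> = \<eta>]
        form_boundD[OF assms(2), where n = n and \<xi> = \<xi> and \<eta> = \<eta>]]
    by (simp add: algebra_simps)
  finally show "cmod (\<Sum>i<n. \<Sum>j<n. (a i j + b i j) * \<xi> j * \<eta> i)
    \<le> (A + B) * L2_set (\<lambda>j. cmod (\<xi> j)) {..<n} * L2_set (\<lambda>i. cmod (\<eta> i)) {..<n}" .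
qed

text \<open>
  A diagonal factor can be moved from the matrix to the vectors that it is tested against.
\<close>

lemma form_bound_diagonal:
  assumes a: "form_bound a B"
    and \<alpha>: "\<And>i. cmod (\<alpha> i) \<le> r" and \<beta>: "\<And>j. cmod (\<beta> j) \<le> s"
  shows "form_bound (\<lambda>i j. \<alpha> i * \<beta> j * a i j) (r * s * B)"
  unfolding form_bound_def
proof (intro allI)
  fix n :: nat and \<xi> \<eta> :: "nat \<Rightarrow> complex"
  have r: "0 \<le> r" and s: "0 \<le> s"
    using \<alpha>[of 0] \<beta>[of 0] norm_ge_zero order_trans by blast+
  have scale: "L2_set (\<lambda>j. cmod (\<gamma> j * \<zeta> j)) {..<n} \<le> t * L2_set (\<lambda>j. cmod (\<zeta> j)) {..<n}"
    if "\<And>j. cmod (\<gamma> j) \<le> t" "0 \<le> t" for \<gamma> \<zeta> :: "nat \<Rightarrow> complex" and t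
  proof -
    have "L2_set (\<lambda>j. cmod (\<gamma> j * \<zeta> j)) {..<n} \<le> L2_set (\<lambda>j. t * cmod (\<zeta> j)) {..<n}"
      by (intro L2_set_mono) (auto simp: norm_mult intro: mult_right_mono that)
    also have "\<dots> = t * L2_set (\<lambda>j. cmod (\<zeta> j)) {..<n}"
      by (rule L2_set_right_distrib[OF that(2), symmetric])
    finally show ?thesis .
  qed
  have "(\<Sum>i<n. \<Sum>j<n. \<alpha> i * \<beta> j * a i j * \<xi> j * \<eta> i)
      = (\<Sum>i<n. \<Sum>j<n. a i j * (\<beta> j * \<xi> j) * (\<alpha> i * \<eta> i))"
    by (simp add: mult_ac)
  also have "cmod \<dots> \<le> B * L2_set (\<lambda>j. cmod (\<beta> j * \<xi> j)) {..<n}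
      * L2_set (\<lambda>i. cmod (\<alpha> i * \<eta> i)) {..<n}"
    by (rule form_boundD[OF a])
  also have "\<dots> \<le> B * (s * L2_set (\<lambda>j. cmod (\<xi> j)) {..<n})
      * (r * L2_set (\<lambda>i. cmod (\<eta> i)) {..<n})"
    by (intro mult_mono scale \<alpha> \<beta> r s order_refl mult_nonneg_nonneg L2_set_nonneg
        form_bound_nonneg[OF a])
  finally show "cmod (\<Sum>i<n. \<Sum>j<n. \<alpha> i * \<beta> j * a i j * \<xi> j * \<eta> i)
    \<le> r * s * B * L2_set (\<lambda>j. cmod (\<xi> j)) {..<n} * L2_set (\<lambda>i. cmod (\<eta> i)) {..<n}"
    by (simp add: mult_ac)
qed

lemma form_bound_limit:
  assumes "\<And>K. form_bound (a K) B" and "\<And>i j. (\<lambda>K. a K i j) \<longlonglongrightarrow> b i j"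
  shows "form_bound b B"
  unfolding form_bound_def
proof (intro allI)
  fix n :: nat and \<xi> \<eta> :: "nat \<Rightarrow> complex"
  have "(\<lambda>K. cmod (\<Sum>i<n. \<Sum>j<n. a K i j * \<xi> j * \<eta> i))
      \<longlonglongrightarrow> cmod (\<Sum>i<n. \<Sum>j<n. b i j * \<xi> j * \<eta> i)"
    by (intro tendsto_intros assms(2))
  then show "cmod (\<Sum>i<n. \<Sum>j<n. b i j * \<xi> j * \<eta> i)
    \<le> B * L2_set (\<lambda>j. cmod (\<xi> j)) {..<n} * L2_set (\<lambda>i. cmod (\<eta> i)) {..<n}"
    by (rule LIMSEQ_le_const2) (use form_boundD[OF assms(1)] in blast)
qed

text \<open>
  With \<open>x\<^sub>i = (x p i)\<^sub>p\<close>, the left-hand side is the norm of \<open>(\<eta>\<^sub>i x\<^sub>i)\<^sub>i\<close>, summed first over \<open>i\<close> and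
  then over \<open>p\<close>; exchanging the sums brings in the norms of the vectors \<open>x\<^sub>i\<close>.
\<close>

lemma L2_set_family:
  fixes x :: "'p \<Rightarrow> nat \<Rightarrow> complex"
  assumes X: "\<And>i. (\<Sum>p\<in>P. (cmod (x p i))\<^sup>2) \<le> C"
  shows "L2_set (\<lambda>p. L2_set (\<lambda>i. cmod (x p i * \<eta> i)) {..<n}) P
    \<le> sqrt C * L2_set (\<lambda>i. cmod (\<eta> i)) {..<n}"
proof -
  have "(\<Sum>p\<in>P. \<Sum>i<n. (cmod (x p i * \<eta> i))\<^sup>2)
      = (\<Sum>i<n. \<Sum>p\<in>P. (cmod (x p i))\<^sup>2 * (cmod (\<eta> i))\<^sup>2)"
    by (subst sum.swap) (simp add: norm_mult power_mult_distrib)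
  also have "\<dots> \<le> (\<Sum>i<n. C * (cmod (\<eta> i))\<^sup>2)"
    unfolding sum_distrib_right[symmetric] by (intro sum_mono mult_right_mono X) simp
  finally have "(\<Sum>p\<in>P. \<Sum>i<n. (cmod (x p i * \<eta> i))\<^sup>2) \<le> C * (\<Sum>i<n. (cmod (\<eta> i))\<^sup>2)"
    by (simp add: sum_distrib_left)
  then show ?thesis
    unfolding L2_set_def by (simp add: sum_nonneg real_sqrt_mult[symmetric])
qed

text \<open>
  The elementary direction of Grothendieck's description of Schur multipliers.  The form of the
  Schur product is the sum over \<open>p\<close> of the form of \<open>a\<close> at the vectors \<open>(y p j \<xi>\<^sub>j)\<^sub>j\<close> and
  \<open>(x p i \<eta>\<^sub>i)\<^sub>i\<close>.  Bounding each term by \<open>B\<close> and applying the Cauchy-Schwarz inequality in \<open>p\<close>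
  leaves the factor \<open>\<surd>C\<close> for each of the two families.
\<close>

lemma schur_bound_gram:
  fixes x y :: "'p \<Rightarrow> nat \<Rightarrow> complex"
  assumes x: "\<And>i. (\<Sum>p\<in>P. (cmod (x p i))\<^sup>2) \<le> C" and y: "\<And>j. (\<Sum>p\<in>P. (cmod (y p j))\<^sup>2) \<le> C"
  shows "schur_bound (\<lambda>i j. \<Sum>p\<in>P. x p i * y p j) C"
  unfolding schur_bound_def form_bound_def
proof (intro allI impI)
  fix a :: "nat \<Rightarrow> nat \<Rightarrow> complex" and B and n :: nat and \<xi> \<eta> :: "nat \<Rightarrow> complex"
  assume "\<forall>n \<xi> \<eta>. cmod (\<Sum>i<n. \<Sum>j<n. a i j * \<xi> j * \<eta> i)
     \<le> B * L2_set (\<lambda>j. cmod (\<xi> j)) {..<n} * L2_set (\<lambda>i. cmod (\<eta> i)) {..<n}"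
  then have a: "form_bound a B" by (simp add: form_bound_def)
  have B: "0 \<le> B" by (rule form_bound_nonneg[OF a])
  have "0 \<le> (\<Sum>p\<in>P. (cmod (x p 0))\<^sup>2)" by (intro sum_nonneg) simp
  then have C: "0 \<le> C" using x[of 0] by linarith
  have "(\<Sum>p\<in>P. L2_set (\<lambda>j. cmod (y p j * \<xi> j)) {..<n}
      * L2_set (\<lambda>i. cmod (x p i * \<eta> i)) {..<n})
      \<le> L2_set (\<lambda>p. L2_set (\<lambda>j. cmod (y p j * \<xi> j)) {..<n}) P
        * L2_set (\<lambda>p. L2_set (\<lambda>i. cmod (x p i * \<eta> i)) {..<n}) P"
    using L2_set_mult_ineq[of "\<lambda>p. L2_set (\<lambda>j. cmod (y p j * \<xi> j)) {..<n}"
      "\<lambda>p. L2_set (\<lambda>i. cmod (x p i * \<eta> i)) {..<n}" P] by (simp add: L2_set_nonneg)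
  also have "\<dots> \<le> (sqrt C * L2_set (\<lambda>j. cmod (\<xi> j)) {..<n})
      * (sqrt C * L2_set (\<lambda>i. cmod (\<eta> i)) {..<n})"
    by (intro mult_mono L2_set_family x y mult_nonneg_nonneg L2_set_nonneg) (simp add: C)
  also have "\<dots> = C * (L2_set (\<lambda>j. cmod (\<xi> j)) {..<n} * L2_set (\<lambda>i. cmod (\<eta> i)) {..<n})"
    using C by (metis mult.assoc mult.left_commute real_sqrt_mult_self abs_of_nonneg)
  finally have cauchy_schwarz: "(\<Sum>p\<in>P. L2_set (\<lambda>j. cmod (y p j * \<xi> j)) {..<n}
      * L2_set (\<lambda>i. cmod (x p i * \<eta> i)) {..<n})
      \<le> C * (L2_set (\<lambda>j. cmod (\<xi> j)) {..<n} * L2_set (\<lambda>i. cmod (\<eta> i)) {..<n})" .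
  have "(\<Sum>i<n. \<Sum>j<n. schur_product (\<lambda>i j. \<Sum>p\<in>P. x p i * y p j) a i j * \<xi> j * \<eta> i)
      = (\<Sum>i<n. \<Sum>j<n. \<Sum>p\<in>P. a i j * (y p j * \<xi> j) * (x p i * \<eta> i))"
    by (simp add: schur_product_def sum_distrib_left sum_distrib_right mult_ac)
  also have "\<dots> = (\<Sum>i<n. \<Sum>p\<in>P. \<Sum>j<n. a i j * (y p j * \<xi> j) * (x p i * \<eta> i))"
    by (intro sum.cong refl sum.swap)
  also have "\<dots> = (\<Sum>p\<in>P. \<Sum>i<n. \<Sum>j<n. a i j * (y p j * \<xi> j) * (x p i * \<eta> i))"
    by (rule sum.swap)
  also have "cmod \<dots> \<le> (\<Sum>p\<in>P. B * L2_set (\<lambda>j. cmod (y p j * \<xi> j)) {..<n}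
      * L2_set (\<lambda>i. cmod (x p i * \<eta> i)) {..<n})"
    by (intro sum_norm_le form_boundD[OF a])
  also have "\<dots> = B * (\<Sum>p\<in>P. L2_set (\<lambda>j. cmod (y p j * \<xi> j)) {..<n}
      * L2_set (\<lambda>i. cmod (x p i * \<eta> i)) {..<n})"
    by (simp add: sum_distrib_left mult_ac)
  also have "\<dots> \<le> B * (C * (L2_set (\<lambda>j. cmod (\<xi> j)) {..<n} * L2_set (\<lambda>i. cmod (\<eta> i)) {..<n}))"
    by (rule mult_left_mono[OF cauchy_schwarz B])
  finally show "cmod (\<Sum>i<n. \<Sum>j<n.
      schur_product (\<lambda>i j. \<Sum>p\<in>P. x p i * y p j) a i j * \<xi> j * \<eta> i)
      \<le> C * B * L2_set (\<lambda>j. cmod (\<xi> j)) {..<n} * L2_set (\<lambda>i. cmod (\<eta> i)) {..<n}"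
    by (simp add: mult_ac)
qed

lemma schur_bound_add:
  assumes "schur_bound M C" "schur_bound N D"
  shows "schur_bound (\<lambda>i j. M i j + N i j) (C + D)"
  unfolding schur_bound_def
proof (intro allI impI)
  fix a B
  assume "form_bound a B"
  then have "form_bound (\<lambda>i j. schur_product M a i j + schur_product N a i j) (C * B + D * B)"
    using assms by (intro form_bound_add) (auto simp: schur_bound_def)
  moreover have "(\<lambda>i j. schur_product M a i j + schur_product N a i j)
      = schur_product (\<lambda>i j. M i j + N i j) a"
    by (simp add: fun_eq_iff schur_product_def algebra_simps)
  ultimately show "form_bound (schur_product (\<lambda>i j. M i j + N i j) a) ((C + D) * B)"
    by (simp add: algebra_simps)
qed

lemma schur_bound_diagonal:
  assumes "schur_bound M C" and "\<And>i. cmod (\<alpha> i) \<le> r" and "\<And>j. cmod (\<beta> j) \<le> s"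
  shows "schur_bound (\<lambda>i j. \<alpha> i * \<beta> j * M i j) (r * s * C)"
  unfolding schur_bound_def
proof (intro allI impI)
  fix a B
  assume "form_bound a B"
  then have "form_bound (schur_product M a) (C * B)"
    using assms(1) by (auto simp: schur_bound_def)
  then have "form_bound (\<lambda>i j. \<alpha> i * \<beta> j * schur_product M a i j) (r * s * (C * B))"
    by (rule form_bound_diagonal) (use assms in auto)
  moreover have "(\<lambda>i j. \<alpha> i * \<beta> j * schur_product M a i j)
      = schur_product (\<lambda>i j. \<alpha> i * \<beta> j * M i j) a"
    by (simp add: fun_eq_iff schur_product_def mult_ac)
  ultimately show "form_bound (schur_product (\<lambda>i j. \<alpha> i * \<beta> j * M i j) a) (r * s * C * B)"
    by (simp add: mult_ac)
qed

lemma schur_bound_sum: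
  assumes "finite P" "\<And>p. p \<in> P \<Longrightarrow> schur_bound (M p) (C p)"
  shows "schur_bound (\<lambda>i j. \<Sum>p\<in>P. M p i j) (\<Sum>p\<in>P. C p)"
  using assms
proof (induction rule: finite_induct)
  case empty
  have "schur_product (\<lambda>_ _. 0) a = (\<lambda>_ _. 0)" for a
    by (simp add: fun_eq_iff schur_product_def)
  then show ?case by (simp add: schur_bound_def form_bound_zero)
next
  case (insert p P)
  then show ?case by (simp add: schur_bound_add)
qed

lemma schur_bound_limit:
  assumes "\<And>K. schur_bound (M K) C" and "\<And>i j. (\<lambda>K. M K i j) \<longlonglongrightarrow> L i j"
  shows "schur_bound L C"
  unfolding schur_bound_def
proof (intro allI impI)
  fix a B
  assume "form_bound a B"
  then have "form_bound (schur_product (M K) a) (C * B)" for K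
    using assms(1) by (auto simp: schur_bound_def)
  then show "form_bound (schur_product L a) (C * B)"
    by (rule form_bound_limit) (auto simp: schur_product_def intro!: tendsto_intros assms(2))
qed

lemma schur_bound_mono:
  assumes "schur_bound M C" "C \<le> D"
  shows "schur_bound M D"
  unfolding schur_bound_def
proof (intro allI impI)
  fix a B
  assume a: "form_bound a B"
  then have "form_bound (schur_product M a) (C * B)"
    using assms(1) by (auto simp: schur_bound_def)
  then show "form_bound (schur_product M a) (D * B)"
    by (rule form_bound_mono) (intro mult_right_mono assms(2) form_bound_nonneg[OF a])
qed

section \<open>Operators and their forms\<close>

lemma L2_set_le_norm_ell2: "L2_set (\<lambda>i. cmod (ell2_nth x i)) {..<n} \<le> norm x"
  unfolding L2_set_def norm_ell2.rep_eq
  by (intro real_sqrt_le_mono sum_le_suminf summable_ell2) auto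

lemma form_bound_matrix_of:
  assumes A: "A \<in> B_ell2"
  shows "form_bound (matrix_of A) (norm A)"
  unfolding form_bound_def
proof (intro allI)
  fix n :: nat and \<xi> \<eta> :: "nat \<Rightarrow> complex"
  define v where "v = (\<Sum>j<n. ell2_scale (\<xi> j) (ell2_basis j))"
  have v: "ell2_nth v i = (if i < n then \<xi> i else 0)" for i
    by (simp add: v_def ell2_nth_sum ell2_nth_scale ell2_nth_basis if_distrib sum.delta
        cong: if_cong)
  have "(\<Sum>i. (cmod (ell2_nth v i))\<^sup>2) = (\<Sum>i<n. (cmod (ell2_nth v i))\<^sup>2)"
    by (rule suminf_finite) (auto simp: v)
  then have norm_v: "norm v = L2_set (\<lambda>j. cmod (\<xi> j)) {..<n}"
    by (simp add: norm_ell2.rep_eq L2_set_def v)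
  have Av: "ell2_nth (blinfun_apply A v) i = (\<Sum>j<n. matrix_of A i j * \<xi> j)" for i
    using A by (simp add: v_def blinfun.sum_right B_ell2_def ell2_nth_sum ell2_nth_scale
        matrix_of_def mult.commute)
  have "cmod (\<Sum>i<n. \<Sum>j<n. matrix_of A i j * \<xi> j * \<eta> i)
      = cmod (\<Sum>i<n. ell2_nth (blinfun_apply A v) i * \<eta> i)"
    by (simp add: Av sum_distrib_right)
  also have "\<dots> \<le> (\<Sum>i<n. \<bar>cmod (ell2_nth (blinfun_apply A v) i)\<bar> * \<bar>cmod (\<eta> i)\<bar>)"
    by (rule sum_norm_le) (simp add: norm_mult)
  also have "\<dots> \<le> L2_set (\<lambda>i. cmod (ell2_nth (blinfun_apply A v) i)) {..<n}
      * L2_set (\<lambda>i. cmod (\<eta> i)) {..<n}"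
    by (rule L2_set_mult_ineq)
  also have "\<dots> \<le> (norm A * norm v) * L2_set (\<lambda>i. cmod (\<eta> i)) {..<n}"
    by (intro mult_right_mono L2_set_nonneg order_trans[OF L2_set_le_norm_ell2] norm_blinfun)
  finally show "cmod (\<Sum>i<n. \<Sum>j<n. matrix_of A i j * \<xi> j * \<eta> i)
    \<le> norm A * L2_set (\<lambda>j. cmod (\<xi> j)) {..<n} * L2_set (\<lambda>i. cmod (\<eta> i)) {..<n}"
    by (simp add: norm_v)
qed

text \<open>
  Testing the form against the conjugate of the image of \<open>\<xi>\<close> turns the bound on the form into a
  bound on that image.  Rows and columns are cut off separately, so that \<open>n\<close> can tend to infinity
  while \<open>m\<close> stays fixed.
\<close>

lemma form_bound_apply:
  assumes a: "form_bound a B" and "m \<le> n"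
  shows "L2_set (\<lambda>i. cmod (\<Sum>j<n. a i j * \<xi> j)) {..<m} \<le> B * L2_set (\<lambda>j. cmod (\<xi> j)) {..<n}"
proof -
  define v where "v i = (\<Sum>j<n. a i j * \<xi> j)" for i
  define S where "S = L2_set (\<lambda>i. cmod (v i)) {..<m}"
  define \<eta> where "\<eta> i = (if i < m then cnj (v i) else 0)" for i
  have SS: "S * S = (\<Sum>i<m. (cmod (v i))\<^sup>2)"
    by (simp add: S_def L2_set_def sum_nonneg)
  have cut: "(\<Sum>i<n. if i < m then f i else 0) = (\<Sum>i<m. f i)" for f :: "nat \<Rightarrow> 'b::comm_monoid_add"
  proof -
    have "{..<n} \<inter> {i. i < m} = {..<m}" using \<open>m \<le> n\<close> by auto
    then show ?thesis by (simp add: sum.If_cases)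
  qed
  have "(\<Sum>i<n. \<Sum>j<n. a i j * \<xi> j * \<eta> i) = (\<Sum>i<n. if i < m then v i * cnj (v i) else 0)"
    by (intro sum.cong) (simp_all add: \<eta>_def v_def sum_distrib_right)
  also have "\<dots> = complex_of_real (S * S)"
    unfolding SS by (simp add: cut complex_norm_square del: of_real_power)
  finally have form: "cmod (\<Sum>i<n. \<Sum>j<n. a i j * \<xi> j * \<eta> i) = S * S"
    by (simp add: S_def L2_set_nonneg norm_mult)
  have "(\<Sum>i<n. (cmod (\<eta> i))\<^sup>2) = (\<Sum>i<n. if i < m then (cmod (v i))\<^sup>2 else 0)"
    by (intro sum.cong) (simp_all add: \<eta>_def)
  then have norm_\<eta>: "L2_set (\<lambda>i. cmod (\<eta> i)) {..<n} = S"
    unfolding L2_set_def S_def by (simp add: cut)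
  have "S * S \<le> B * L2_set (\<lambda>j. cmod (\<xi> j)) {..<n} * S"
    using form_boundD[OF a, where n = n and \<xi> = \<xi> and \<eta> = \<eta>] by (simp only: form norm_\<eta>)
  moreover have "0 \<le> S" "0 \<le> B * L2_set (\<lambda>j. cmod (\<xi> j)) {..<n}"
    by (auto simp: S_def L2_set_nonneg form_bound_nonneg[OF a])
  ultimately have "S \<le> B * L2_set (\<lambda>j. cmod (\<xi> j)) {..<n}"
    by (cases "S = 0") auto
  then show ?thesis by (simp add: S_def v_def)
qed

text \<open>
  Apply the sections of the matrix to the conjugate of the \<open>i\<close>-th row, cut off at \<open>n\<close>: the squared
  norm \<open>T\<close> of this vector is a coordinate of its image, whence \<open>T \<le> B \<surd>T\<close>.
\<close>

lemma form_bound_row: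
  assumes a: "form_bound a B"
  shows "summable (\<lambda>j. (cmod (a i j))\<^sup>2)"
proof (rule summableI_nonneg_bounded[where x = "B\<^sup>2"])
  fix n
  define \<xi> where "\<xi> j = (if j < n then cnj (a i j) else 0)" for j
  define N where "N = max n (Suc i)"
  define T where "T = (\<Sum>j<n. (cmod (a i j))\<^sup>2)"
  have cut: "(\<Sum>j<N. if j < n then f j else 0) = (\<Sum>j<n. f j)" for f :: "nat \<Rightarrow> 'b::comm_monoid_add"
  proof -
    have "{..<N} \<inter> {j. j < n} = {..<n}" by (auto simp: N_def)
    then show ?thesis by (simp add: sum.If_cases)
  qed
  have "(\<Sum>j<N. a i j * \<xi> j) = (\<Sum>j<N. if j < n then a i j * cnj (a i j) else 0)"
    by (intro sum.cong) (simp_all add: \<xi>_def)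
  then have "(\<Sum>j<N. a i j * \<xi> j) = complex_of_real T"
    by (simp add: T_def cut complex_norm_square del: of_real_power)
  then have "T = cmod (\<Sum>j<N. a i j * \<xi> j)"
    by (simp only: norm_of_real) (simp add: T_def sum_nonneg)
  also have "\<dots> \<le> L2_set (\<lambda>i. cmod (\<Sum>j<N. a i j * \<xi> j)) {..<N}"
    by (rule member_le_L2_set) (auto simp: N_def)
  also have "\<dots> \<le> B * L2_set (\<lambda>j. cmod (\<xi> j)) {..<N}"
    by (rule form_bound_apply[OF a order_refl])
  also have "(\<Sum>j<N. (cmod (\<xi> j))\<^sup>2) = (\<Sum>j<N. if j < n then (cmod (a i j))\<^sup>2 else 0)"
    by (intro sum.cong) (simp_all add: \<xi>_def)
  then have "L2_set (\<lambda>j. cmod (\<xi> j)) {..<N} = sqrt T"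
    unfolding L2_set_def by (simp add: cut T_def)
  finally have "T \<le> B * sqrt T" .
  moreover have T: "0 \<le> T" by (simp add: T_def sum_nonneg)
  ultimately have square: "sqrt T * sqrt T \<le> B * sqrt T" by simp
  have "sqrt T \<le> B"
  proof (cases "T = 0")
    case False
    then show ?thesis using T by (intro mult_right_le_imp_le[OF square]) simp
  qed (simp add: form_bound_nonneg[OF a])
  then have "T \<le> B\<^sup>2" using sqrt_le_D by blast
  then show "(\<Sum>j<n. (cmod (a i j))\<^sup>2) \<le> B\<^sup>2" by (simp add: T_def)
qed simp

text \<open>
  Conversely, a bounded form is the form of an operator: its rows are square summable, so
  \<open>\<Sum>\<^sub>j a\<^sub>i\<^sub>j x\<^sub>j\<close> converges for \<open>x\<close> in \<open>\<ell>\<^sub>2\<close>, and the bounds on the finite sections pass to the limit.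
\<close>

lemma form_bound_operator:
  assumes a: "form_bound a B"
  shows "\<exists>T\<in>B_ell2. matrix_of T = a \<and> norm T \<le> B"
proof -
  note B = form_bound_nonneg[OF a]
  define v where "v x i = (\<Sum>j. a i j * ell2_nth x j)" for x i
  have row: "summable (\<lambda>j. a i j * ell2_nth x j)" for x i
  proof (rule summable_comparison_test')
    show "summable (\<lambda>j. (cmod (a i j))\<^sup>2 + (cmod (ell2_nth x j))\<^sup>2)"
      by (intro summable_add form_bound_row[OF a] summable_ell2)
    fix j assume "j \<ge> (0::nat)"
    have "2 * cmod (a i j) * cmod (ell2_nth x j) \<le> (cmod (a i j))\<^sup>2 + (cmod (ell2_nth x j))\<^sup>2"
      by (rule sum_squares_bound)
    moreover have "0 \<le> cmod (a i j) * cmod (ell2_nth x j)" by simp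
    ultimately show "norm (a i j * ell2_nth x j) \<le> (cmod (a i j))\<^sup>2 + (cmod (ell2_nth x j))\<^sup>2"
      unfolding norm_mult by linarith
  qed
  have bound: "L2_set (\<lambda>i. cmod (v x i)) {..<m} \<le> B * norm x" for x m
  proof (rule LIMSEQ_le_const2)
    show "(\<lambda>n. L2_set (\<lambda>i. cmod (\<Sum>j<n. a i j * ell2_nth x j)) {..<m})
        \<longlonglongrightarrow> L2_set (\<lambda>i. cmod (v x i)) {..<m}"
      unfolding L2_set_def v_def by (intro tendsto_intros summable_LIMSEQ row)
    have "L2_set (\<lambda>i. cmod (\<Sum>j<n. a i j * ell2_nth x j)) {..<m} \<le> B * norm x"
      if "m \<le> n" for n
      by (rule order_trans[OF form_bound_apply[OF a that]])
        (intro mult_left_mono L2_set_le_norm_ell2 B)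
    then show "\<exists>N. \<forall>n\<ge>N. L2_set (\<lambda>i. cmod (\<Sum>j<n. a i j * ell2_nth x j)) {..<m} \<le> B * norm x"
      by blast
  qed
  have sq: "(\<Sum>i<m. (cmod (v x i))\<^sup>2) \<le> (B * norm x)\<^sup>2" for x m
    using bound[of x m] unfolding L2_set_def by (rule sqrt_le_D)
  have v2: "summable (\<lambda>i. (cmod (v x i))\<^sup>2)" for x
    by (rule summableI_nonneg_bounded[OF _ sq]) simp
  define T where "T x = Abs_ell2 (v x)" for x
  have T_nth: "ell2_nth (T x) = v x" for x
    using v2[of x] by (simp add: T_def Abs_ell2_inverse)
  have norm_T: "norm (T x) \<le> norm x * B" for x
  proof -
    have "(\<Sum>i. (cmod (v x i))\<^sup>2) \<le> (B * norm x)\<^sup>2"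
      by (rule suminf_le_const[OF v2 sq])
    then show ?thesis
      unfolding norm_ell2.rep_eq[of "T x"] T_nth
      by (intro real_le_lsqrt) (simp_all add: B mult.commute)
  qed
  have add: "T (x + y) = T x + T y" for x y
    by (rule iffD1[OF ell2_nth_inject], rule ext)
      (simp add: T_nth ell2_nth_add v_def suminf_add[OF row row] distrib_left)
  have scaleR: "T (r *\<^sub>R x) = r *\<^sub>R T x" for r x
    by (rule iffD1[OF ell2_nth_inject], rule ext)
      (simp add: T_nth scaleR_ell2.rep_eq v_def suminf_mult[OF row, symmetric] mult.left_commute)
  have scale: "T (ell2_scale c x) = ell2_scale c (T x)" for c x
    by (rule iffD1[OF ell2_nth_inject], rule ext)
      (simp add: T_nth ell2_nth_scale v_def suminf_mult[OF row, symmetric] mult.left_commute)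
  have T: "bounded_linear T"
    by (rule bounded_linear_intro[OF add scaleR norm_T])
  note Blinfun_T = bounded_linear_Blinfun_apply[OF T]
  have "v (ell2_basis j) i = a i j" for i j
  proof -
    have "v (ell2_basis j) i = (\<Sum>k. if k = j then a i k else 0)"
      unfolding v_def by (intro suminf_cong) (simp add: ell2_nth_basis)
    also have "\<dots> = a i j" using sums_single[of j "a i"] sums_unique by metis
    finally show ?thesis .
  qed
  then have "matrix_of (Blinfun T) = a"
    by (simp add: fun_eq_iff matrix_of_def Blinfun_T T_nth)
  moreover have "Blinfun T \<in> B_ell2"
    by (simp add: B_ell2_def Blinfun_T scale)
  moreover have "norm (Blinfun T) \<le> B"
    by (rule norm_blinfun_bound[OF B]) (use norm_T in \<open>simp add: Blinfun_T mult.commute\<close>)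
  ultimately show ?thesis by blast
qed

lemma schur_multiplier_if_schur_bound:
  assumes "schur_bound M C"
  shows "schur_multiplier M"
proof -
  have "\<forall>A\<in>B_ell2. \<exists>T. T \<in> B_ell2 \<and> matrix_of T = schur_product M (matrix_of A)
      \<and> norm T \<le> C * norm A"
    using form_bound_operator form_bound_matrix_of assms unfolding schur_bound_def by blast
  from bchoice[OF this] show ?thesis
    unfolding schur_multiplier_def by blast
qed

section \<open>Triangular blocks and convex Hankel weights\<close>

lemma triangle_gram:
  "real (N - (i + j)) = (\<Sum>m<N. of_bool (i \<le> m) * of_bool (m + j < N))"
proof -
  have "(\<Sum>m<N. of_bool (i \<le> m) * of_bool (m + j < N) :: real)
      = (\<Sum>m<N. if m \<in> {i..<N - j} then 1 else 0)"
    by (intro sum.cong) auto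
  also have "\<dots> = real (card ({..<N} \<inter> {i..<N - j}))"
    by (subst sum.If_cases) (simp_all del: atLeastLessThan_iff)
  also have "{..<N} \<inter> {i..<N - j} = {i..<N - j}" by auto
  finally show ?thesis by (simp add: add.commute)
qed

lemma schur_bound_triangle:
  "schur_bound (\<lambda>i j. complex_of_real (real (N - (i + j)))) (real N)"
proof -
  have "schur_bound (\<lambda>i j. \<Sum>m<N. of_bool (i \<le> m) * of_bool (m + j < N)) (real N)"
  proof (rule schur_bound_gram)
    show "(\<Sum>m<N. (cmod (of_bool (i \<le> m)))\<^sup>2) \<le> real N" for i
      using sum_bounded_above[of "{..<N}" "\<lambda>m. (cmod (of_bool (i \<le> m)))\<^sup>2" 1] by simp
    show "(\<Sum>m<N. (cmod (of_bool (m + j < N)))\<^sup>2) \<le> real N" for j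
      using sum_bounded_above[of "{..<N}" "\<lambda>m. (cmod (of_bool (m + j < N)))\<^sup>2" 1] by simp
  qed
  moreover have "complex_of_real (real (N - (i + j)))
      = (\<Sum>m<N. of_bool (i \<le> m) * of_bool (m + j < N))" for i j
    unfolding triangle_gram by simp
  ultimately show ?thesis by simp
qed

text \<open>
  Replacing \<open>i\<close> and \<open>j\<close> by \<open>min i N\<close> and \<open>min j N\<close> changes nothing on the support of the triangle,
  and makes both diagonal factors bounded by \<open>N\<close>.
\<close>

lemma schur_bound_triangle_commutator:
  assumes c: "0 \<le> c"
  shows "schur_bound (\<lambda>i j. complex_of_real (c * (real j - real i) * real (N - (i + j))))
    (2 * c * (real N)\<^sup>2)"
proof -
  define t where "t i = complex_of_real (real (min i N))" for i
  have t: "cmod (t i) \<le> real N" for i by (simp add: t_def)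
  have "schur_bound (\<lambda>i j. complex_of_real c * t j * complex_of_real (real (N - (i + j))))
      (c * real N * real N)"
    by (rule schur_bound_diagonal[OF schur_bound_triangle]) (use c t in auto)
  moreover have "schur_bound (\<lambda>i j. t i * (- complex_of_real c)
      * complex_of_real (real (N - (i + j)))) (real N * c * real N)"
    by (rule schur_bound_diagonal[OF schur_bound_triangle]) (use c t in auto)
  ultimately have "schur_bound (\<lambda>i j. complex_of_real c * t j * complex_of_real (real (N - (i + j)))
      + t i * (- complex_of_real c) * complex_of_real (real (N - (i + j))))
      (c * real N * real N + real N * c * real N)"
    by (rule schur_bound_add)
  moreover have "complex_of_real c * t j * complex_of_real (real (N - (i + j)))
      + t i * (- complex_of_real c) * complex_of_real (real (N - (i + j)))
      = complex_of_real (c * (real j - real i) * real (N - (i + j)))" for i j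
    by (cases "i + j < N") (simp_all add: t_def algebra_simps)
  moreover have "c * real N * real N + real N * c * real N = 2 * c * (real N)\<^sup>2"
    by (simp add: power2_eq_square)
  ultimately show ?thesis by simp
qed

text \<open>
  The decrements \<open>h(n) - h(n + 1)\<close> decrease to \<open>0\<close>, hence are nonnegative; then \<open>h\<close> itself decreases
  to \<open>0\<close>.
\<close>

lemma convex_summable_decreasing:
  fixes h :: "nat \<Rightarrow> real"
  assumes convex: "\<And>n. 2 * h (n + 1) \<le> h n + h (n + 2)" and "summable h"
  shows "h (n + 1) \<le> h n" "0 \<le> h n"
proof -
  note lim = summable_LIMSEQ_zero[OF \<open>summable h\<close>]
  have "(\<lambda>n. h n - h (n + 1)) \<longlonglongrightarrow> 0 - 0"
    by (intro tendsto_diff lim LIMSEQ_ignore_initial_segment)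
  moreover have "decseq (\<lambda>n. h n - h (n + 1))"
    by (rule decseq_SucI) (use convex in \<open>simp add: algebra_simps\<close>)
  ultimately have *: "h (n + 1) \<le> h n" for n
    using decseq_ge[of "\<lambda>n. h n - h (n + 1)" 0 n] by simp
  then show "h (n + 1) \<le> h n" .
  have "decseq h" by (rule decseq_SucI) (use * in simp)
  then show "0 \<le> h n" using lim by (rule decseq_ge)
qed

text \<open>
  Two summations by parts.  The boundary terms are kept because they are nonnegative for
  convex summable \<open>h\<close> and \<open>K \<ge> 1\<close>, and because the one with \<open>h K - h (K + 1)\<close> yields its decay.
\<close>

lemma second_difference_moment:
  fixes h :: "nat \<Rightarrow> real"
  shows "(\<Sum>k<K. (real (k + 1))\<^sup>2 * (h k - 2 * h (k + 1) + h (k + 2)))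
    + (real K)\<^sup>2 * (h K - h (K + 1)) + (2 * real K - 1) * h K = 2 * (\<Sum>k<K. h k) - h 0"
  by (induction K) (simp_all add: algebra_simps power2_eq_square)

lemma second_difference_moment_le:
  fixes h :: "nat \<Rightarrow> real"
  assumes convex: "\<And>n. 2 * h (n + 1) \<le> h n + h (n + 2)" and h: "summable h"
  shows "(\<Sum>k<K. (real (k + 1))\<^sup>2 * (h k - 2 * h (k + 1) + h (k + 2)))
    + (real K)\<^sup>2 * (h K - h (K + 1)) \<le> 2 * suminf h"
proof (cases "K = 0")
  case True
  then show ?thesis
    using convex_summable_decreasing(2)[OF convex h] h by (simp add: suminf_nonneg)
next
  case False
  note dec = convex_summable_decreasing[OF convex h]
  have "0 \<le> (2 * real K - 1) * h K"
    by (intro mult_nonneg_nonneg dec(2)) (use False in auto)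
  moreover have "(\<Sum>k<K. h k) \<le> suminf h"
    by (intro sum_le_suminf h) (auto simp: dec(2))
  ultimately show ?thesis
    using second_difference_moment[where K = K and h = h] dec(2)[of 0] by linarith
qed

text \<open>
  Again summation by parts.  The truncated difference in \<open>real (k + 1 - n)\<close> is the positive part, so
  the terms with \<open>k < n\<close> vanish and the induction effectively starts at \<open>n\<close>.
\<close>

lemma triangle_expansion:
  fixes h :: "nat \<Rightarrow> real"
  shows "(\<Sum>k<n + K. real (k + 1 - n) * (h k - 2 * h (k + 1) + h (k + 2)))
    = h n - h (n + K) - real K * (h (n + K) - h (n + K + 1))"
proof (induction K)
  case 0
  have "(\<Sum>k<n. real (k + 1 - n) * (h k - 2 * h (k + 1) + h (k + 2))) = 0"
    by (intro sum.neutral) auto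
  then show ?case by simp
next
  case (Suc K)
  then show ?case by (simp add: algebra_simps)
qed

lemma triangle_expansion_sums:
  fixes h :: "nat \<Rightarrow> real"
  assumes convex: "\<And>n. 2 * h (n + 1) \<le> h n + h (n + 2)" and h: "summable h"
  shows "(\<lambda>k. real (k + 1 - n) * (h k - 2 * h (k + 1) + h (k + 2))) sums h n"
proof -
  note dec = convex_summable_decreasing[OF convex h]
  note lim = summable_LIMSEQ_zero[OF h]
  have quad: "(real K)\<^sup>2 * (h K - h (K + 1)) \<le> 2 * suminf h" for K
  proof -
    have "0 \<le> (\<Sum>k<K. (real (k + 1))\<^sup>2 * (h k - 2 * h (k + 1) + h (k + 2)))"
      by (intro sum_nonneg mult_nonneg_nonneg) (use convex in \<open>auto simp: algebra_simps\<close>)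
    then show ?thesis
      using second_difference_moment_le[OF convex h, of K] by linarith
  qed
  \<comment> \<open>The boundary term of the expansion vanishes because the moment identity bounds it by a
    multiple of \<open>1 / K\<close>.\<close>
  have "(\<lambda>K. real K * (h K - h (K + 1))) \<longlonglongrightarrow> 0"
  proof (rule real_tendsto_sandwich)
    show "\<forall>\<^sub>F K in sequentially. 0 \<le> real K * (h K - h (K + 1))"
      using dec(1) by (auto intro!: always_eventually)
    show "\<forall>\<^sub>F K in sequentially. real K * (h K - h (K + 1)) \<le> 2 * suminf h / real K"
      using eventually_ge_at_top[of 1]
      by eventually_elim (use quad in \<open>auto simp: field_simps power2_eq_square\<close>)
  qed (auto intro: lim_const_over_n)
  then have "(\<lambda>K. real (K + n) * (h (K + n) - h (K + n + 1))) \<longlonglongrightarrow> 0"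
    by (rule LIMSEQ_ignore_initial_segment)
  moreover have "(\<lambda>K. real n * (h (K + n) - h (K + (n + 1)))) \<longlonglongrightarrow> real n * (0 - 0)"
    by (intro tendsto_intros LIMSEQ_ignore_initial_segment lim)
  ultimately have "(\<lambda>K. real (K + n) * (h (K + n) - h (K + n + 1))
      - real n * (h (K + n) - h (K + (n + 1)))) \<longlonglongrightarrow> 0 - real n * (0 - 0)"
    by (rule tendsto_diff)
  then have flux: "(\<lambda>K. real K * (h (n + K) - h (n + K + 1))) \<longlonglongrightarrow> 0"
    by (simp add: algebra_simps)
  have "(\<lambda>K. h n - h (K + n) - real K * (h (n + K) - h (n + K + 1))) \<longlonglongrightarrow> h n - 0 - 0"
    by (intro tendsto_diff tendsto_const flux LIMSEQ_ignore_initial_segment lim)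
  then have "(\<lambda>K. \<Sum>k<n + K. real (k + 1 - n) * (h k - 2 * h (k + 1) + h (k + 2)))
      \<longlonglongrightarrow> h n"
    unfolding triangle_expansion by (simp add: add.commute)
  then show ?thesis
    unfolding sums_def by (subst (asm) add.commute) (rule LIMSEQ_offset)
qed

text \<open>
  The \<open>k\<close>-th second difference multiplies the triangle of side \<open>N = k + 1\<close>, which costs
  \<open>2 (k + 1)\<^sup>2\<close>; by the moment bound, all partial sums have norm at most \<open>4 \<Sum> h\<close>.
\<close>

lemma schur_bound_convex_hankel:
  fixes h :: "nat \<Rightarrow> real"
  assumes convex: "\<And>n. 2 * h (n + 1) \<le> h n + h (n + 2)" and h: "summable h"
  shows "schur_bound (\<lambda>i j. complex_of_real ((real j - real i) * h (i + j))) (4 * suminf h)"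
proof (rule schur_bound_limit)
  define c where "c k = h k - 2 * h (k + 1) + h (k + 2)" for k
  have c: "0 \<le> c k" for k using convex[of k] by (simp add: c_def)
  note dec = convex_summable_decreasing[OF convex h]
  show "schur_bound (\<lambda>i j. \<Sum>k<K. complex_of_real
      (c k * (real j - real i) * real (k + 1 - (i + j)))) (4 * suminf h)" for K
  proof (rule schur_bound_mono)
    show "schur_bound (\<lambda>i j. \<Sum>k<K. complex_of_real
        (c k * (real j - real i) * real (k + 1 - (i + j)))) (\<Sum>k<K. 2 * c k * (real (k + 1))\<^sup>2)"
      by (intro schur_bound_sum schur_bound_triangle_commutator c) simp
    have "0 \<le> (real K)\<^sup>2 * (h K - h (K + 1))"
      using dec(1)[of K] by simp
    then have "(\<Sum>k<K. (real (k + 1))\<^sup>2 * c k) \<le> 2 * suminf h"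
      using second_difference_moment_le[OF convex h, of K] unfolding c_def by linarith
    moreover have "(\<Sum>k<K. 2 * c k * (real (k + 1))\<^sup>2) = 2 * (\<Sum>k<K. (real (k + 1))\<^sup>2 * c k)"
      by (simp add: sum_distrib_left mult_ac)
    ultimately show "(\<Sum>k<K. 2 * c k * (real (k + 1))\<^sup>2) \<le> 4 * suminf h"
      by linarith
  qed
  fix i j
  have "(\<lambda>k. (real j - real i) * (real (k + 1 - (i + j)) * c k)) sums ((real j - real i) * h (i + j))"
    unfolding c_def by (intro sums_mult triangle_expansion_sums convex h)
  then have "(\<lambda>k. complex_of_real (c k * (real j - real i) * real (k + 1 - (i + j))))
      sums complex_of_real ((real j - real i) * h (i + j))"
    by (subst sums_of_real_iff) (simp add: mult_ac)
  then show "(\<lambda>K. \<Sum>k<K. complex_of_real (c k * (real j - real i) * real (k + 1 - (i + j))))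
      \<longlonglongrightarrow> complex_of_real ((real j - real i) * h (i + j))"
    by (simp add: sums_def)
qed

section \<open>Convexity and summability of the logarithmic weights\<close>

text \<open>
  Positivity is part of the notion, so that \<open>ln\<close>, \<open>powr\<close> and division behave as expected.
\<close>

definition log_concave :: "(nat \<Rightarrow> real) \<Rightarrow> bool" where
  "log_concave p \<longleftrightarrow> (\<forall>n. 0 < p n \<and> p n * p (n + 2) \<le> (p (n + 1))\<^sup>2)"

text \<open>
  The geometric mean is at most the arithmetic mean.
\<close>

lemma log_concave_if_concave:
  assumes pos: "\<And>n. 0 < p n" and "\<And>n. p n + p (n + 2) \<le> 2 * p (n + 1)"
  shows "log_concave p"
  unfolding log_concave_def
proof (intro allI conjI pos)
  fix n
  have "0 \<le> (p n - p (n + 2))\<^sup>2" by simp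
  then have "4 * (p n * p (n + 2)) \<le> (p n + p (n + 2))\<^sup>2"
    by (simp add: power2_eq_square algebra_simps)
  also have "\<dots> \<le> (2 * p (n + 1))\<^sup>2"
    by (intro power_mono assms(2) add_nonneg_nonneg less_imp_le pos)
  finally show "p n * p (n + 2) \<le> (p (n + 1))\<^sup>2"
    by (simp add: power_mult_distrib)
qed

lemma concave_ln:
  assumes "log_concave p"
  shows "ln (p n) + ln (p (n + 2)) \<le> 2 * ln (p (n + 1))"
proof -
  have pos: "0 < p n" for n using assms by (simp add: log_concave_def)
  have "ln (p n) + ln (p (n + 2)) = ln (p n * p (n + 2))"
    using pos[of n] pos[of "n + 2"] by (simp add: ln_mult)
  also have "\<dots> \<le> ln ((p (n + 1))\<^sup>2)"
    using assms pos[of n] pos[of "n + 2"] pos[of "n + 1"]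
    by (intro ln_mono) (auto simp: log_concave_def)
  also have "\<dots> = 2 * ln (p (n + 1))"
    using pos by (simp add: ln_realpow)
  finally show ?thesis .
qed

lemma log_concave_mult:
  assumes p: "log_concave p" and q: "log_concave q"
  shows "log_concave (\<lambda>n. p n * q n)"
  unfolding log_concave_def
proof (intro allI conjI)
  fix n
  have pos: "0 < p n" "0 < q n" for n using p q by (auto simp: log_concave_def)
  show "0 < p n * q n" using pos by simp
  have "(p n * p (n + 2)) * (q n * q (n + 2)) \<le> (p (n + 1))\<^sup>2 * (q (n + 1))\<^sup>2"
    using p q by (intro mult_mono) (auto simp: log_concave_def less_imp_le)
  then show "p n * q n * (p (n + 2) * q (n + 2)) \<le> (p (n + 1) * q (n + 1))\<^sup>2"
    by (simp add: power_mult_distrib mult_ac)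
qed

lemma log_concave_powr:
  assumes p: "log_concave p" and r: "0 \<le> r"
  shows "log_concave (\<lambda>n. p n powr r)"
  unfolding log_concave_def
proof (intro allI conjI)
  fix n
  have pos: "0 < p n" for n using p by (auto simp: log_concave_def)
  show "0 < p n powr r" using pos[of n] by simp
  have "p n powr r * p (n + 2) powr r = (p n * p (n + 2)) powr r"
    using pos[of n] pos[of "n + 2"] by (simp add: powr_mult)
  also have "\<dots> \<le> ((p (n + 1))\<^sup>2) powr r"
    using p pos[of n] pos[of "n + 2"] r
    by (intro powr_mono2) (auto simp: log_concave_def less_imp_le)
  also have "\<dots> = (p (n + 1) powr r)\<^sup>2"
    using pos[of "n + 1"] by (simp add: power2_eq_square powr_mult)
  finally show "p n powr r * p (n + 2) powr r \<le> (p (n + 1) powr r)\<^sup>2" .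
qed

text \<open>
  The arithmetic mean of \<open>1 / p n\<close> and \<open>1 / p (n + 2)\<close> is at least their geometric mean, which
  log-concavity bounds below by \<open>1 / p (n + 1)\<close>.
\<close>

lemma convex_inverse:
  assumes p: "log_concave p"
  shows "2 * (1 / p (n + 1)) \<le> 1 / p n + 1 / p (n + 2)"
proof (rule power2_le_imp_le)
  have pos: "0 < p n" for n using p by (auto simp: log_concave_def)
  show "0 \<le> 1 / p n + 1 / p (n + 2)"
    using pos[of n] pos[of "n + 2"] by simp
  have "(2 * (1 / p (n + 1)))\<^sup>2 = 4 * (1 / (p (n + 1))\<^sup>2)"
    by (simp add: power2_eq_square)
  also have "\<dots> \<le> 4 * (1 / (p n * p (n + 2)))"
    using p pos[of n] pos[of "n + 1"] pos[of "n + 2"]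
    by (intro mult_left_mono divide_left_mono mult_pos_pos zero_less_power)
      (auto simp: log_concave_def)
  also have "\<dots> \<le> (1 / p n + 1 / p (n + 2))\<^sup>2"
    using sum_squares_bound[of "1 / p n" "1 / p (n + 2)"]
    by (simp add: power2_eq_square algebra_simps)
  finally show "(2 * (1 / p (n + 1)))\<^sup>2 \<le> (1 / p n + 1 / p (n + 2))\<^sup>2" .
qed

lemma ln_diff_lower:
  fixes u v :: real
  assumes "0 < u" "0 < v"
  shows "(v - u) / v \<le> ln v - ln u"
proof -
  have "ln (u / v) \<le> u / v - 1"
    using assms by (intro ln_le_minus_one) simp
  then show ?thesis using assms by (simp add: ln_div diff_divide_distrib)
qed

text \<open>
  The tangent inequality for the convex function \<open>exp (- e t)\<close> between \<open>t = ln u\<close> and \<open>t = ln v\<close>,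
  combined with the lower bound for \<open>ln v - ln u\<close>.
\<close>

lemma powr_telescope:
  fixes u v :: real
  assumes u: "0 < u" and v: "0 < v" and e: "0 < e"
  shows "e * ((v - u) / v powr (1 + e)) \<le> u powr (- e) - v powr (- e)"
proof -
  have "e * ((v - u) / v) \<le> e * (ln v - ln u)"
    by (intro mult_left_mono ln_diff_lower) (use assms in auto)
  also have "\<dots> \<le> exp (e * (ln v - ln u)) - 1"
    using exp_ge_add_one_self[of "e * (ln v - ln u)"] by linarith
  finally have "v powr (- e) * (e * ((v - u) / v))
      \<le> v powr (- e) * (exp (e * (ln v - ln u)) - 1)"
    by (intro mult_left_mono) auto
  moreover have "v powr (- e) * exp (e * (ln v - ln u)) = u powr (- e)"
    using u v by (simp add: powr_def exp_add[symmetric] algebra_simps)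
  moreover have "v powr (- e) * (e * ((v - u) / v)) = e * ((v - u) / v powr (1 + e))"
    using v by (simp add: powr_add powr_minus field_simps)
  ultimately show ?thesis by (simp add: algebra_simps)
qed

lemma summable_increments_powr:
  fixes u :: "nat \<Rightarrow> real"
  assumes pos: "\<And>n. 0 < u n" and inc: "\<And>n. u n \<le> u (Suc n)" and e: "0 < e"
  shows "summable (\<lambda>n. (u (Suc n) - u n) / u (Suc n) powr (1 + e))"
proof (rule summableI_nonneg_bounded[where x = "u 0 powr (- e) / e"])
  show "0 \<le> (u (Suc n) - u n) / u (Suc n) powr (1 + e)" for n
    using inc[of n] by simp
  fix n
  have "e * (\<Sum>k<n. (u (Suc k) - u k) / u (Suc k) powr (1 + e))
      \<le> (\<Sum>k<n. u k powr (- e) - u (Suc k) powr (- e))"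
    unfolding sum_distrib_left by (intro sum_mono powr_telescope pos e)
  also have "\<dots> = u 0 powr (- e) - u n powr (- e)"
    by (rule sum_lessThan_telescope')
  also have "\<dots> \<le> u 0 powr (- e)" by simp
  finally show "(\<Sum>k<n. (u (Suc k) - u k) / u (Suc k) powr (1 + e)) \<le> u 0 powr (- e) / e"
    using e by (simp add: field_simps)
qed

lemma ln_gt_one_shift: "1 < ln (real (n + 3))"
proof -
  have "exp (1::real) < 3" using e_less_272 by simp
  then have "exp (1::real) < real (n + 3)" by simp
  then show ?thesis by (subst ln_exp[symmetric]) (subst ln_less_cancel_iff, auto)
qed

theorem corollary3p2:
  fixes \<epsilon> :: real
  assumes "\<epsilon> > 0"
  shows "schur_multiplier (\<lambda>i j. complex_of_real (E_entry \<epsilon> (Suc i) (Suc j))) \<and>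
         schur_multiplier (\<lambda>i j. complex_of_real (F_entry \<epsilon> (Suc i) (Suc j)))"
proof -
  \<comment> \<open>In \<open>0\<close>-based indices, \<open>i + j + 1\<close> becomes \<open>i + j + 3\<close>.  As \<open>3 > e\<close>, even the iterated logarithm is
    positive at the first index.\<close>
  define p0 where "p0 n = real (n + 3)" for n
  define p1 where "p1 n = ln (p0 n)" for n
  define p2 where "p2 n = ln (p1 n)" for n
  have p0: "0 < p0 n" for n by (simp add: p0_def)
  have p1: "1 < p1 n" for n using ln_gt_one_shift by (simp add: p1_def p0_def)
  then have p1': "0 < p1 n" for n by (rule less_trans[OF zero_less_one])
  have p2: "0 < p2 n" for n unfolding p2_def by (rule ln_gt_zero[OF p1])
  have lc0: "log_concave p0"
    by (rule log_concave_if_concave) (auto simp: p0_def)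
  have lc1: "log_concave p1"
    by (rule log_concave_if_concave[OF p1']) (unfold p1_def, rule concave_ln[OF lc0])
  have lc2: "log_concave p2"
    by (rule log_concave_if_concave[OF p2]) (unfold p2_def, rule concave_ln[OF lc1])
  have d1: "1 / p0 (Suc n) \<le> p1 (Suc n) - p1 n" for n
    using ln_diff_lower[OF p0 p0, of "Suc n" n] by (simp add: p1_def p0_def)
  have d2: "1 / (p0 (Suc n) * p1 (Suc n)) \<le> p2 (Suc n) - p2 n" for n
  proof -
    have "1 / p0 (Suc n) / p1 (Suc n) \<le> (p1 (Suc n) - p1 n) / p1 (Suc n)"
      by (intro divide_right_mono d1 less_imp_le p1')
    also have "\<dots> \<le> p2 (Suc n) - p2 n"
      unfolding p2_def by (rule ln_diff_lower[OF p1' p1'])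
    finally show ?thesis by simp
  qed
  have inc1: "p1 n \<le> p1 (Suc n)" for n
  proof -
    have "0 \<le> 1 / p0 (Suc n)" using p0[of "Suc n"] by simp
    then show ?thesis using d1[of n] by linarith
  qed
  have inc2: "p2 n \<le> p2 (Suc n)" for n
    unfolding p2_def using inc1 p1' by (simp add: ln_le_cancel_iff)
  define h where "h n = 1 / (p0 n * p1 n powr (1 + \<epsilon>))" for n
  define g where "g n = 1 / (p0 n * p1 n * p2 n powr (1 + \<epsilon>))" for n
  have "summable (\<lambda>n. h (Suc n))"
  proof (rule summable_comparison_test')
    show "summable (\<lambda>n. (p1 (Suc n) - p1 n) / p1 (Suc n) powr (1 + \<epsilon>))"
      by (rule summable_increments_powr[where u = p1, OF p1' inc1 assms])
    show "norm (h (Suc n)) \<le> (p1 (Suc n) - p1 n) / p1 (Suc n) powr (1 + \<epsilon>)" if "n \<ge> 0" for n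
      using divide_right_mono[OF d1[of n], of "p1 (Suc n) powr (1 + \<epsilon>)"] p0[of "Suc n"]
      by (simp add: h_def)
  qed
  then have "summable h" by (simp only: summable_Suc_iff)
  moreover have "2 * h (n + 1) \<le> h n + h (n + 2)" for n
    unfolding h_def
    by (rule convex_inverse) (intro log_concave_mult log_concave_powr lc0 lc1, use assms in simp)
  ultimately have E: "schur_bound (\<lambda>i j. complex_of_real ((real j - real i) * h (i + j)))
      (4 * suminf h)"
    by (intro schur_bound_convex_hankel)
  have "summable (\<lambda>n. g (Suc n))"
  proof (rule summable_comparison_test')
    show "summable (\<lambda>n. (p2 (Suc n) - p2 n) / p2 (Suc n) powr (1 + \<epsilon>))"
      by (rule summable_increments_powr[where u = p2, OF p2 inc2 assms])
    show "norm (g (Suc n)) \<le> (p2 (Suc n) - p2 n) / p2 (Suc n) powr (1 + \<epsilon>)" if "n \<ge> 0" for n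
      using divide_right_mono[OF d2[of n], of "p2 (Suc n) powr (1 + \<epsilon>)"] p0[of "Suc n"]
        p1'[of "Suc n"]
      by (simp add: g_def)
  qed
  then have "summable g" by (simp only: summable_Suc_iff)
  moreover have "2 * g (n + 1) \<le> g n + g (n + 2)" for n
    unfolding g_def
    by (rule convex_inverse)
      (intro log_concave_mult log_concave_powr lc0 lc1 lc2, use assms in simp)
  ultimately have F: "schur_bound (\<lambda>i j. complex_of_real ((real j - real i) * g (i + j)))
      (4 * suminf g)"
    by (intro schur_bound_convex_hankel)
  have "E_entry \<epsilon> (Suc i) (Suc j) = (real j - real i) * h (i + j)" for i j
    by (simp add: E_entry_def h_def p1_def p0_def add_ac numeral_3_eq_3)
  moreover have "F_entry \<epsilon> (Suc i) (Suc j) = (real j - real i) * g (i + j)" for i j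
    by (simp add: F_entry_def g_def p2_def p1_def p0_def add_ac numeral_3_eq_3)
  ultimately show ?thesis
    using schur_multiplier_if_schur_bound[OF E] schur_multiplier_if_schur_bound[OF F]
    by (simp only: simp_thms)
qed

end
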